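(* The generalized array multiplication formula is linear in each input array, and it generalizes the usual matrix multiplication, trace, and Kronecker product operations. Explicitly: (1) (Linearity.) For every wiring diagram $\Phi\colon P_1,\ldots,P_n\to P'$, the function $\mathrm{Arr}(\Phi)\colon\mathrm{Arr}(P_1)\times\cdots\times\mathrm{Arr}(P_n)\to\mathrm{Arr}(P')$ is linear over the semiring $\mathbb{B}\mathrm{ool}$ in each argument: for each $i$, all $c,c'\in\mathbb{B}\mathrm{ool}$, all $M,N\in\mathrm{Arr}(P_i)$ and all fixed arrays $A_j\in\mathrm{Arr}(P_j)$, $j\neq i$, $$\mathrm{Arr}(\Phi)(\ldots,cM+c'N,\ldots)=c\,\mathrm{Arr}(\Phi)(\ldots,M,\ldots)+c'\,\mathrm{Arr}(\Phi)(\ldots,N,\ldots),$$ where the displayed entries are in the $i$th position and the other positions are filled by the $A_j$. (2) (Matrix multiplication.) Let $m,n,p\geq2$. For the wiring diagram with inner packs $P_M=\{m_1,n_1\}$, $P_N=\{n_2,p_2\}$, outer pack $P'=\{m',p'\}$, links $\Lambda=\{\ell_m,\ell_n,\ell_p\}$ of resolutions $m,n,p$, and linking function $m_1,m'\mapsto\ell_m$; $n_1,n_2\mapsto\ell_n$; $p_2,p'\mapsto\ell_p$, one has $\mathrm{Arr}(\Phi)(M,N)=MN$ (matrix product) for every $m\times n$ matrix $M$ and $n\times p$ matrix $N$ over $\mathbb{B}\mathrm{ool}$. (3) (Trace.) Let $n\geq 2$. For the wiring diagram with a single inner pack consisting of two ports of resolution $n$, both mapped to the unique link (of resolution $n$),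 and with empty outer pack, one has $\mathrm{Arr}(\Phi)(A)=\mathrm{Tr}(A)=\sum_{i=1}^nA(i,i)$ for every $n\times n$ matrix $A$ over $\mathbb{B}\mathrm{ool}$. (4) (Kronecker product.) Let $m_1,n_1,m_2,n_2\geq2$. For the wiring diagram with two inner packs, the $i$th having two ports of resolutions $m_i$ and $n_i$ ($i=1,2$), four links each containing exactly one of these four inner ports, and an outer pack with four ports, one attached to each link, one has $\mathrm{Arr}(\Phi)(M_1,M_2)=M_1\otimes M_2$, i.e. its entry at $(i_1,i_2,j_1,j_2)$ is $M_1(i_1,j_1)M_2(i_2,j_2)$, for all $m_1\times n_1$ matrices $M_1$ and $m_2\times n_2$ matrices $M_2$ over $\mathbb{B}\mathrm{ool}$.
   Context: $\mathbb{B}\mathrm{ool}=\{0,1\}$ is the semiring with $+$ given by OR and multiplication given by AND; matrix operations are taken over this semiring. A pack is a tuple $(P,a,b,r)$ where $P$ is a finite set (of "ports"), $a,b\colon P\to\mathbb{R}$ satisfy $a(p)\leq b(p)$ for all $p$, and $r\colon P\to\mathbb{N}_{\geq2}$ (the resolution). Put $\mathrm{Entr}(P)=\prod_{p\in P}\{1,\ldots,r(p)\}$, and let $\mathrm{Arr}(P)$ be the set of functions $\mathrm{Entr}(P)\to\mathbb{B}\mathrm{ool}$ (for $P=\emptyset$, $\mathrm{Arr}(P)=\{0,1\}$), with pointwise addition and scalar multiplication. A wiring diagram $\Phi\colon P_1,\ldots,P_n\to P'$, for packs $P_1,\ldots,P_n$ (inner) and $P'$ (outer), consists of a finite set $\Lambda$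 of links, a function $\varphi\colon P_1\sqcup\cdots\sqcup P_n\sqcup P'\to\Lambda$ (the linking function) whose restriction to $P_1\sqcup\cdots\sqcup P_n$ is surjective, and functions $a_\Lambda,b_\Lambda\colon\Lambda\to\mathbb{R}$, $r_\Lambda\colon\Lambda\to\mathbb{N}_{\geq2}$ whose composites with $\varphi$ are the given bounds and resolution functions on ports. (In the specific diagrams of the claim the bounds are arbitrary subject to linked ports having equal bounds.) Put $\mathrm{Entr}(\Lambda)=\prod_{\ell\in\Lambda}\{1,\ldots,r_\Lambda(\ell)\}$. Precomposing with the restrictions of $\varphi$ to $P_i$ and $P'$ gives functions $\mathrm{Entr}^i_\Phi\colon\mathrm{Entr}(\Lambda)\to\mathrm{Entr}(P_i)$ and $\mathrm{Entr}'_\Phi\colon\mathrm{Entr}(\Lambda)\to\mathrm{Entr}(P')$; i.e. the $p$-coordinate of the image of $e$ is the $\varphi(p)$-coordinate of $e$. The generalized array multiplication formula defines $A'=\mathrm{Arr}(\Phi)(A_1,\ldots,A_n)\in\mathrm{Arr}(P')$ by $$A'(e')=\sum_{e\in\mathrm{Entr}(\Lambda),\ \mathrm{Entr}'_\Phi(e)=e'}\ \prod_{i=1}^nA_i\big(\mathrm{Entr}^i_\Phi(e)\big).$$ *)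

theory Defs
  imports "Jordan_Normal_Form.Matrix" "HOL-Library.FuncSet"
begin

text \<open>The Boolean semiring: \<open>True\<close> is 1, \<open>False\<close> is 0.  With this instance, finite sums and
  products over \<^typ>\<open>bool\<close> and the product of \<^typ>\<open>bool mat\<close> are those over this semiring.\<close>

instantiation bool :: comm_semiring_1
begin

definition zero_bool :: bool where "0 = False"
definition one_bool :: bool where "1 = True"
definition plus_bool :: "bool \<Rightarrow> bool \<Rightarrow> bool" where "x + y = (x \<or> y)"
definition times_bool :: "bool \<Rightarrow> bool \<Rightarrow> bool" where "x * y = (x \<and> y)"

instance
  by standard (auto simp: zero_bool_def one_bool_def plus_bool_def times_bool_def)

end

record 'p pack =
  ports :: "'p set"
  lower :: "'p \<Rightarrow> real"
  upper :: "'p \<Rightarrow> real"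
  resolution :: "'p \<Rightarrow> nat"

definition is_pack :: "'p pack \<Rightarrow> bool" where
  "is_pack P \<longleftrightarrow> finite (ports P) \<and>
     (\<forall>p\<in>ports P. lower P p \<le> upper P p \<and> 2 \<le> resolution P p)"

definition entries :: "'x set \<Rightarrow> ('x \<Rightarrow> nat) \<Rightarrow> ('x \<Rightarrow> nat) set" where
  "entries X r = (\<Pi>\<^sub>E x\<in>X. {1..r x})"

definition Entr :: "'p pack \<Rightarrow> ('p \<Rightarrow> nat) set" where
  "Entr P = entries (ports P) (resolution P)"

text \<open>Arrays are extensional functions, so equality in \<open>Arr P\<close> is equality of functions on
  \<open>Entr P\<close>; accordingly the pointwise operations are restricted to \<open>Entr P\<close>.\<close>

definition Arr :: "'p pack \<Rightarrow> (('p \<Rightarrow> nat) \<Rightarrow> bool) set" where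
  "Arr P = Entr P \<rightarrow>\<^sub>E UNIV"

definition arr_add ::
    "'p pack \<Rightarrow> (('p \<Rightarrow> nat) \<Rightarrow> bool) \<Rightarrow> (('p \<Rightarrow> nat) \<Rightarrow> bool) \<Rightarrow> ('p \<Rightarrow> nat) \<Rightarrow> bool" where
  "arr_add P A B = (\<lambda>e\<in>Entr P. A e + B e)"

definition arr_smult ::
    "'p pack \<Rightarrow> bool \<Rightarrow> (('p \<Rightarrow> nat) \<Rightarrow> bool) \<Rightarrow> ('p \<Rightarrow> nat) \<Rightarrow> bool" where
  "arr_smult P c A = (\<lambda>e\<in>Entr P. c * A e)"

text \<open>The inner packs form a list, numbered from 0.  In the disjoint union of all ports, \<open>Inl (i, p)\<close>
  is the port \<open>p\<close> of the \<open>i\<close>th inner pack and \<open>Inr q\<close> is the port \<open>q\<close> of the outer pack.\<close>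

record ('p, 'q, 'l) wiring =
  inner_packs :: "'p pack list"
  outer_pack :: "'q pack"
  links :: "'l set"
  linking :: "(nat \<times> 'p) + 'q \<Rightarrow> 'l"
  link_lower :: "'l \<Rightarrow> real"
  link_upper :: "'l \<Rightarrow> real"
  link_resolution :: "'l \<Rightarrow> nat"

definition inner_ports :: "('p, 'q, 'l) wiring \<Rightarrow> (nat \<times> 'p) set" where
  "inner_ports \<Phi> = (SIGMA i:{..<length (inner_packs \<Phi>)}. ports (inner_packs \<Phi> ! i))"

definition wiring_diagram :: "('p, 'q, 'l) wiring \<Rightarrow> bool" where
  "wiring_diagram \<Phi> \<longleftrightarrow>
     (\<forall>P\<in>set (inner_packs \<Phi>). is_pack P) \<and> is_pack (outer_pack \<Phi>) \<and>
     finite (links \<Phi>) \<and> (\<forall>l\<in>links \<Phi>. 2 \<le> link_resolution \<Phi> l) \<and>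
     linking \<Phi> \<in> inner_ports \<Phi> <+> ports (outer_pack \<Phi>) \<rightarrow> links \<Phi> \<and>
     linking \<Phi> ` Inl ` inner_ports \<Phi> = links \<Phi> \<and>
     (\<forall>(i, p)\<in>inner_ports \<Phi>.
        link_lower \<Phi> (linking \<Phi> (Inl (i, p))) = lower (inner_packs \<Phi> ! i) p \<and>
        link_upper \<Phi> (linking \<Phi> (Inl (i, p))) = upper (inner_packs \<Phi> ! i) p \<and>
        link_resolution \<Phi> (linking \<Phi> (Inl (i, p))) = resolution (inner_packs \<Phi> ! i) p) \<and>
     (\<forall>q\<in>ports (outer_pack \<Phi>).
        link_lower \<Phi> (linking \<Phi> (Inr q)) = lower (outer_pack \<Phi>) q \<and>
        link_upper \<Phi> (linking \<Phi> (Inr q)) = upper (outer_pack \<Phi>) q \<and>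
        link_resolution \<Phi> (linking \<Phi> (Inr q)) = resolution (outer_pack \<Phi>) q)"

definition Entr_links :: "('p, 'q, 'l) wiring \<Rightarrow> ('l \<Rightarrow> nat) set" where
  "Entr_links \<Phi> = entries (links \<Phi>) (link_resolution \<Phi>)"

definition Entr_inner :: "('p, 'q, 'l) wiring \<Rightarrow> nat \<Rightarrow> ('l \<Rightarrow> nat) \<Rightarrow> 'p \<Rightarrow> nat" where
  "Entr_inner \<Phi> i e = (\<lambda>p\<in>ports (inner_packs \<Phi> ! i). e (linking \<Phi> (Inl (i, p))))"

definition Entr_outer :: "('p, 'q, 'l) wiring \<Rightarrow> ('l \<Rightarrow> nat) \<Rightarrow> 'q \<Rightarrow> nat" where
  "Entr_outer \<Phi> e = (\<lambda>q\<in>ports (outer_pack \<Phi>). e (linking \<Phi> (Inr q)))"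

definition Arr_map ::
    "('p, 'q, 'l) wiring \<Rightarrow> (('p \<Rightarrow> nat) \<Rightarrow> bool) list \<Rightarrow> ('q \<Rightarrow> nat) \<Rightarrow> bool" where
  "Arr_map \<Phi> As = (\<lambda>e'\<in>Entr (outer_pack \<Phi>).
     \<Sum>e | e \<in> Entr_links \<Phi> \<and> Entr_outer \<Phi> e = e'.
       \<Prod>i<length (inner_packs \<Phi>). (As ! i) (Entr_inner \<Phi> i e))"

lemma Entr_inner_in_Entr:
  assumes "wiring_diagram \<Phi>" "e \<in> Entr_links \<Phi>" "i < length (inner_packs \<Phi>)"
  shows "Entr_inner \<Phi> i e \<in> Entr (inner_packs \<Phi> ! i)"
proof -
  have "e (linking \<Phi> (Inl (i, p))) \<in> {1..resolution (inner_packs \<Phi> ! i) p}"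
    if "p \<in> ports (inner_packs \<Phi> ! i)" for p
  proof -
    have ip: "(i, p) \<in> inner_ports \<Phi>"
      using that assms(3) by (simp add: inner_ports_def)
    have "linking \<Phi> (Inl (i, p)) \<in> links \<Phi>"
      using assms(1) ip unfolding wiring_diagram_def by blast
    moreover have "link_resolution \<Phi> (linking \<Phi> (Inl (i, p))) = resolution (inner_packs \<Phi> ! i) p"
      using assms(1) ip unfolding wiring_diagram_def by blast
    ultimately show ?thesis
      using assms(2) PiE_mem unfolding Entr_links_def entries_def by metis
  qed
  then show ?thesis
    unfolding Entr_inner_def Entr_def entries_def by (intro restrict_PiE_iff[THEN iffD2] ballI)
qed

lemma Entr_outer_in_Entr:
  assumes "wiring_diagram \<Phi>" "e \<in> Entr_links \<Phi>"
  shows "Entr_outer \<Phi> e \<in> Entr (outer_pack \<Phi>)"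
proof -
  have "e (linking \<Phi> (Inr q)) \<in> {1..resolution (outer_pack \<Phi>) q}"
    if "q \<in> ports (outer_pack \<Phi>)" for q
  proof -
    have "linking \<Phi> (Inr q) \<in> links \<Phi>"
      using assms(1) that unfolding wiring_diagram_def by blast
    moreover have "link_resolution \<Phi> (linking \<Phi> (Inr q)) = resolution (outer_pack \<Phi>) q"
      using assms(1) that unfolding wiring_diagram_def by blast
    ultimately show ?thesis
      using assms(2) PiE_mem unfolding Entr_links_def entries_def by metis
  qed
  then show ?thesis
    unfolding Entr_outer_def Entr_def entries_def by (intro restrict_PiE_iff[THEN iffD2] ballI)
qed

lemma Arr_map_in_Arr: "Arr_map \<Phi> As \<in> Arr (outer_pack \<Phi>)"
  by (simp add: Arr_map_def Arr_def)

text \<open>The array on a pack with two ports that corresponds to a matrix, where port \<open>p\<close> carries the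
  row index and port \<open>q\<close> the column index.  Entries are numbered from 1, but \<^typ>\<open>'a mat\<close> is
  indexed from 0.\<close>

definition arr_of_mat :: "'p pack \<Rightarrow> 'p \<Rightarrow> 'p \<Rightarrow> bool mat \<Rightarrow> ('p \<Rightarrow> nat) \<Rightarrow> bool" where
  "arr_of_mat P p q M = (\<lambda>e\<in>Entr P. M $$ (e p - 1, e q - 1))"

text \<open>The identification of scalars with arrays on a pack without ports, for which \<open>Entr P\<close> has
  exactly one element.\<close>

definition arr_of_scalar :: "'p pack \<Rightarrow> bool \<Rightarrow> ('p \<Rightarrow> nat) \<Rightarrow> bool" where
  "arr_of_scalar P c = (\<lambda>e\<in>Entr P. c)"

definition mat_trace :: "'a :: comm_monoid_add mat \<Rightarrow> 'a" where
  "mat_trace A = (\<Sum>i<dim_row A. A $$ (i, i))"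

definition kronecker_mat :: "'a :: times mat \<Rightarrow> 'a mat \<Rightarrow> 'a mat" where
  "kronecker_mat A B = mat (dim_row A * dim_row B) (dim_col A * dim_col B)
     (\<lambda>(i, j). A $$ (i div dim_row B, j div dim_col B) * B $$ (i mod dim_row B, j mod dim_col B))"

text \<open>The array on a pack with four ports that corresponds to a block matrix with blocks of size
  \<open>m \<times> n\<close>: ports \<open>p\<^sub>1\<close> and \<open>q\<^sub>1\<close> number the block row and block column, \<open>p\<^sub>2\<close> and \<open>q\<^sub>2\<close> the
  row and column inside the block.\<close>

definition arr_of_block_mat ::
    "'p pack \<Rightarrow> 'p \<Rightarrow> 'p \<Rightarrow> 'p \<Rightarrow> 'p \<Rightarrow> nat \<Rightarrow> nat \<Rightarrow> bool mat \<Rightarrow> ('p \<Rightarrow> nat) \<Rightarrow> bool" where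
  "arr_of_block_mat P p\<^sub>1 p\<^sub>2 q\<^sub>1 q\<^sub>2 m n K =
     (\<lambda>e\<in>Entr P. K $$ ((e p\<^sub>1 - 1) * m + (e p\<^sub>2 - 1), (e q\<^sub>1 - 1) * n + (e q\<^sub>2 - 1)))"

end

theory Submission
  imports Defs
begin

text \<open>The entries of the links lying over a given outer entry are parametrised by the values on the
  links without an outer port: one index for matrix multiplication and for the trace, none for the
  Kronecker product, where the sum has a single term.\<close>

section \<open>Resolutions across links, and entries as extensional functions\<close>

lemma outer_resolution:
  assumes "wiring_diagram \<Phi>" "q \<in> ports (outer_pack \<Phi>)"
  shows "resolution (outer_pack \<Phi>) q = link_resolution \<Phi> (linking \<Phi> (Inr q))"
  using assms unfolding wiring_diagram_def by metis

lemma inner_resolution: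
  assumes "wiring_diagram \<Phi>" "i < length (inner_packs \<Phi>)" "p \<in> ports (inner_packs \<Phi> ! i)"
  shows "resolution (inner_packs \<Phi> ! i) p = link_resolution \<Phi> (linking \<Phi> (Inl (i, p)))"
proof -
  have "(i, p) \<in> inner_ports \<Phi>"
    using assms(2,3) by (simp add: inner_ports_def)
  then show ?thesis
    using assms(1) unfolding wiring_diagram_def by fastforce
qed

text \<open>A port has the resolution of its link, so the range can be given through the link. This
  is the form that \<open>Entr_linksI\<close> asks for when an outer entry supplies the link
  values.\<close>

lemma Entr_outer_pack_mem:
  assumes "wiring_diagram \<Phi>" "e \<in> Entr (outer_pack \<Phi>)" "q \<in> ports (outer_pack \<Phi>)"
  shows "e q \<in> {1..link_resolution \<Phi> (linking \<Phi> (Inr q))}"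
  using assms outer_resolution[OF assms(1,3)] unfolding Entr_def entries_def by (metis PiE_mem)

text \<open>Witnesses are built by \<open>restrict\<close> because members of
  \<open>Entr_links\<close> must be \<open>undefined\<close> off the links.\<close>

lemma Entr_linksI:
  assumes "\<And>l. l \<in> links \<Phi> \<Longrightarrow> f l \<in> {1..link_resolution \<Phi> l}"
  shows "restrict f (links \<Phi>) \<in> Entr_links \<Phi>"
  using assms by (auto simp: Entr_links_def entries_def)

lemma Entr_links_mem:
  "e \<in> Entr_links \<Phi> \<Longrightarrow> l \<in> links \<Phi> \<Longrightarrow> e l \<in> {1..link_resolution \<Phi> l}"
  by (auto simp: Entr_links_def entries_def)

text \<open>An extensional function is determined by its values on its domain. This serves to
  recover a link entry from the values read off it.\<close>

lemma Entr_links_eqI: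
  assumes "e \<in> Entr_links \<Phi>" "\<And>l. l \<in> links \<Phi> \<Longrightarrow> f l = e l"
  shows "restrict f (links \<Phi>) = e"
  using assms by (auto simp: Entr_links_def entries_def PiE_iff intro: extensionalityI[of _ "links \<Phi>"])

lemma Entr_outer_eqI:
  assumes "e' \<in> Entr (outer_pack \<Phi>)"
    and "\<And>q. q \<in> ports (outer_pack \<Phi>) \<Longrightarrow> e (linking \<Phi> (Inr q)) = e' q"
  shows "Entr_outer \<Phi> e = e'"
  using assms by (auto simp: Entr_outer_def Entr_def entries_def PiE_iff
      intro!: extensionalityI[of _ "ports (outer_pack \<Phi>)"])

lemma Entr_outer_apply:
  "Entr_outer \<Phi> e = e' \<Longrightarrow> q \<in> ports (outer_pack \<Phi>) \<Longrightarrow> e (linking \<Phi> (Inr q)) = e' q"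
  by (auto simp: Entr_outer_def)

lemma Arr_map_apply:
  assumes "e' \<in> Entr (outer_pack \<Phi>)"
  shows "Arr_map \<Phi> As e' = (\<Sum>e | e \<in> Entr_links \<Phi> \<and> Entr_outer \<Phi> e = e'.
           \<Prod>i<length (inner_packs \<Phi>). (As ! i) (Entr_inner \<Phi> i e))"
  using assms by (simp add: Arr_map_def)

text \<open>Both sides of each array equation below are restricted functions, so outside
  \<open>Entr\<close> of the outer pack both are \<open>undefined\<close>. This settles the second
  case of each extensionality argument.\<close>

lemma Arr_map_outside: "e' \<notin> Entr (outer_pack \<Phi>) \<Longrightarrow> Arr_map \<Phi> As e' = undefined"
  by (simp add: Arr_map_def)

text \<open>The projected entry lies in \<open>Entr\<close> of the inner pack, so the restriction in
  \<open>arr_of_mat\<close> falls away. The concrete diagrams use this to replace ports by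
  links.\<close>

lemma arr_of_mat_Entr_inner:
  assumes "wiring_diagram \<Phi>" "e \<in> Entr_links \<Phi>" "i < length (inner_packs \<Phi>)"
    and "p \<in> ports (inner_packs \<Phi> ! i)" "q \<in> ports (inner_packs \<Phi> ! i)"
  shows "arr_of_mat (inner_packs \<Phi> ! i) p q M (Entr_inner \<Phi> i e) =
           M $$ (e (linking \<Phi> (Inl (i, p))) - 1, e (linking \<Phi> (Inl (i, q))) - 1)"
  using Entr_inner_in_Entr[OF assms(1-3)] assms(4,5)
  by (simp add: arr_of_mat_def) (simp add: Entr_inner_def)

section \<open>Linearity in each argument\<close>

text \<open>In every summand the \<open>i\<close>th array contributes exactly one factor. Once it is
  isolated, distributivity in the semiring and additivity of finite sums give the claim.\<close>

lemma Arr_map_linear: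
  assumes wd: "wiring_diagram \<Phi>" and len: "length As = length (inner_packs \<Phi>)"
    and i: "i < length As"
  shows "Arr_map \<Phi> (As[i := arr_add (inner_packs \<Phi> ! i)
                               (arr_smult (inner_packs \<Phi> ! i) c M)
                               (arr_smult (inner_packs \<Phi> ! i) c' N)]) =
        arr_add (outer_pack \<Phi>)
          (arr_smult (outer_pack \<Phi>) c (Arr_map \<Phi> (As[i := M])))
          (arr_smult (outer_pack \<Phi>) c' (Arr_map \<Phi> (As[i := N])))" (is "?L = ?R")
proof
  fix e'
  let ?n = "length (inner_packs \<Phi>)"
  let ?S = "{e. e \<in> Entr_links \<Phi> \<and> Entr_outer \<Phi> e = e'}"
  \<comment> \<open>The factors from the other positions, which the update at \<open>i\<close> does
    not touch.\<close>
  define rest where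
    "rest e = (\<Prod>j\<in>{..<?n} - {i}. (As ! j) (Entr_inner \<Phi> j e))" for e
  \<comment> \<open>\<open>X\<close> is arbitrary, so one factorization serves the linear
    combination as well as \<open>M\<close> and \<open>N\<close> alone.\<close>
  have prod: "(\<Prod>j<?n. (As[i := X] ! j) (Entr_inner \<Phi> j e)) = X (Entr_inner \<Phi> i e) * rest e"
    for X e
  proof -
    have "(\<Prod>j<?n. (As[i := X] ! j) (Entr_inner \<Phi> j e)) =
        (As[i := X] ! i) (Entr_inner \<Phi> i e) *
        (\<Prod>j\<in>{..<?n} - {i}. (As[i := X] ! j) (Entr_inner \<Phi> j e))"
      using i len by (intro prod.remove) auto
    also have "(\<Prod>j\<in>{..<?n} - {i}. (As[i := X] ! j) (Entr_inner \<Phi> j e)) = rest e"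
      unfolding rest_def by (intro prod.cong) auto
    finally show ?thesis
      using i by simp
  qed
  show "?L e' = ?R e'"
  proof (cases "e' \<in> Entr (outer_pack \<Phi>)")
    case True
    have "?L e' = (\<Sum>e\<in>?S. c * (M (Entr_inner \<Phi> i e) * rest e) + c' * (N (Entr_inner \<Phi> i e) * rest e))"
      unfolding Arr_map_apply[OF True] prod
    proof (rule sum.cong[OF refl])
      fix e
      assume "e \<in> ?S"
      \<comment> \<open>At such an entry the restrictions in \<open>arr_add\<close> and
        \<open>arr_smult\<close> disappear and the operations are those of the semiring.\<close>
      then have "Entr_inner \<Phi> i e \<in> Entr (inner_packs \<Phi> ! i)"
        using Entr_inner_in_Entr[OF wd] i len by simp
      then show "arr_add (inner_packs \<Phi> ! i) (arr_smult (inner_packs \<Phi> ! i) c M)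
            (arr_smult (inner_packs \<Phi> ! i) c' N) (Entr_inner \<Phi> i e) * rest e =
          c * (M (Entr_inner \<Phi> i e) * rest e) + c' * (N (Entr_inner \<Phi> i e) * rest e)"
        by (simp add: arr_add_def arr_smult_def distrib_right mult.assoc)
    qed
    also have "\<dots> = c * Arr_map \<Phi> (As[i := M]) e' + c' * Arr_map \<Phi> (As[i := N]) e'"
      unfolding Arr_map_apply[OF True] prod by (simp only: sum.distrib sum_distrib_left)
    also have "\<dots> = ?R e'"
      using True by (simp add: arr_add_def arr_smult_def)
    finally show ?thesis .
  qed (simp add: Arr_map_outside arr_add_def)
qed

section \<open>Matrix multiplication\<close>

text \<open>The outer ports fix the values on \<open>l\<^sub>m\<close> and \<open>l\<^sub>p\<close>,
  so only the value on \<open>l\<^sub>n\<close> varies; summing over it is the row-by-column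
  sum.\<close>

lemma Arr_map_mat_mult:
  assumes wd: "wiring_diagram \<Phi>"
    and packs: "inner_packs \<Phi> = [P\<^sub>M, P\<^sub>N]"
    and ports: "ports P\<^sub>M = {m\<^sub>1, n\<^sub>1}" "ports P\<^sub>N = {n\<^sub>2, p\<^sub>2}" "ports (outer_pack \<Phi>) = {m', p'}"
    and links: "links \<Phi> = {l\<^sub>m, l\<^sub>n, l\<^sub>p}" "distinct [l\<^sub>m, l\<^sub>n, l\<^sub>p]"
    and res: "link_resolution \<Phi> l\<^sub>m = m" "link_resolution \<Phi> l\<^sub>n = n" "link_resolution \<Phi> l\<^sub>p = p"
    and linking: "linking \<Phi> (Inl (0, m\<^sub>1)) = l\<^sub>m" "linking \<Phi> (Inr m') = l\<^sub>m"
      "linking \<Phi> (Inl (0, n\<^sub>1)) = l\<^sub>n" "linking \<Phi> (Inl (1, n\<^sub>2)) = l\<^sub>n"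
      "linking \<Phi> (Inl (1, p\<^sub>2)) = l\<^sub>p" "linking \<Phi> (Inr p') = l\<^sub>p"
    and mats: "M \<in> carrier_mat m n" "N \<in> carrier_mat n p"
  shows "Arr_map \<Phi> [arr_of_mat P\<^sub>M m\<^sub>1 n\<^sub>1 M, arr_of_mat P\<^sub>N n\<^sub>2 p\<^sub>2 N] =
           arr_of_mat (outer_pack \<Phi>) m' p' (M * N)" (is "?L = ?R")
proof
  fix e'
  show "?L e' = ?R e'"
  proof (cases "e' \<in> Entr (outer_pack \<Phi>)")
    case True
    have rng: "e' m' \<in> {1..m}" "e' p' \<in> {1..p}"
      using Entr_outer_pack_mem[OF wd True, of m'] Entr_outer_pack_mem[OF wd True, of p']
      by (simp_all add: ports linking res)
    \<comment> \<open>The link values over \<open>e'\<close> with summation index \<open>k\<close>.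
      \<open>Suc k\<close> converts a matrix index counted from 0 into an entry counted from 1; the
      last branch is for \<open>l\<^sub>p\<close>.\<close>
    let ?g = "\<lambda>k l. if l = l\<^sub>m then e' m' else if l = l\<^sub>n then Suc k else e' p'"
    have "?L e' = (\<Sum>e | e \<in> Entr_links \<Phi> \<and> Entr_outer \<Phi> e = e'.
        M $$ (e l\<^sub>m - 1, e l\<^sub>n - 1) * N $$ (e l\<^sub>n - 1, e l\<^sub>p - 1))"
      unfolding Arr_map_apply[OF True]
    proof (rule sum.cong[OF refl])
      fix e
      assume "e \<in> {e. e \<in> Entr_links \<Phi> \<and> Entr_outer \<Phi> e = e'}"
      then show "(\<Prod>i<length (inner_packs \<Phi>).
            ([arr_of_mat P\<^sub>M m\<^sub>1 n\<^sub>1 M, arr_of_mat P\<^sub>N n\<^sub>2 p\<^sub>2 N] ! i) (Entr_inner \<Phi> i e)) =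
          M $$ (e l\<^sub>m - 1, e l\<^sub>n - 1) * N $$ (e l\<^sub>n - 1, e l\<^sub>p - 1)"
        using arr_of_mat_Entr_inner[OF wd, of e 0 m\<^sub>1 n\<^sub>1 M]
          arr_of_mat_Entr_inner[OF wd, of e 1 n\<^sub>2 p\<^sub>2 N] linking
        by (simp add: packs ports lessThan_Suc mult.commute)
    qed
    \<comment> \<open>The summation range is chosen to match \<open>scalar_prod_def\<close>; the
      bijection reads off the value on \<open>l\<^sub>n\<close> and lowers it by one.\<close>
    also have "\<dots> = (\<Sum>k\<in>{0..<n}. M $$ (e' m' - 1, k) * N $$ (k, e' p' - 1))"
    proof (rule sum.reindex_bij_witness[where i = "\<lambda>k. restrict (?g k) (links \<Phi>)"
            and j = "\<lambda>e. e l\<^sub>n - 1"])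
      fix e
      assume "e \<in> {e. e \<in> Entr_links \<Phi> \<and> Entr_outer \<Phi> e = e'}"
      then have e: "e \<in> Entr_links \<Phi>" "e l\<^sub>m = e' m'" "e l\<^sub>p = e' p'"
        using Entr_outer_apply[of \<Phi> e e' m'] Entr_outer_apply[of \<Phi> e e' p']
        by (simp_all add: ports linking)
      \<comment> \<open>The lower bound 1 matters: subtraction on naturals is truncated, and
        \<open>Suc (e l\<^sub>n - 1)\<close> must give back \<open>e l\<^sub>n\<close>.\<close>
      have ln: "e l\<^sub>n \<in> {1..n}"
        using Entr_links_mem[OF e(1), of l\<^sub>n] by (simp add: links res)
      then show "e l\<^sub>n - 1 \<in> {0..<n}"
        by auto
      show "restrict (?g (e l\<^sub>n - 1)) (links \<Phi>) = e"
        using e ln by (intro Entr_links_eqI) (auto simp: links)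
      show "M $$ (e' m' - 1, e l\<^sub>n - 1) * N $$ (e l\<^sub>n - 1, e' p' - 1) =
          M $$ (e l\<^sub>m - 1, e l\<^sub>n - 1) * N $$ (e l\<^sub>n - 1, e l\<^sub>p - 1)"
        by (simp add: e)
    next
      fix k
      assume k: "k \<in> {0..<n}"
      \<comment> \<open>As the links are distinct, the branches of \<open>?g k\<close> set the three
        values independently, which recovers \<open>e'\<close> on the outer ports and
        \<open>k\<close> on \<open>l\<^sub>n\<close>.\<close>
      have "restrict (?g k) (links \<Phi>) \<in> Entr_links \<Phi>"
        using rng k links(2) by (intro Entr_linksI) (auto simp: links(1) res)
      moreover have "Entr_outer \<Phi> (restrict (?g k) (links \<Phi>)) = e'"
        using links(2) by (intro Entr_outer_eqI[OF True]) (auto simp: ports linking links(1))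
      ultimately show "restrict (?g k) (links \<Phi>) \<in> {e. e \<in> Entr_links \<Phi> \<and> Entr_outer \<Phi> e = e'}"
        by simp
      show "restrict (?g k) (links \<Phi>) l\<^sub>n - 1 = k"
        using links(2) by (auto simp: links(1))
    qed
    also have "\<dots> = (M * N) $$ (e' m' - 1, e' p' - 1)"
    proof -
      \<comment> \<open>An entry of \<open>M * N\<close> unfolds to a scalar product only for
        indices within the dimensions.\<close>
      have "e' m' - 1 < m" "e' p' - 1 < p"
        using rng by auto
      then show ?thesis
        using mats by (simp add: scalar_prod_def)
    qed
    also have "\<dots> = ?R e'"
      using True by (simp add: arr_of_mat_def)
    finally show ?thesis .
  qed (simp add: Arr_map_outside arr_of_mat_def)
qed

section \<open>Trace\<close>

text \<open>Both ports sit on one link, so row and column index coincide; with nothing fixed from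
  outside, the sum runs over the whole diagonal.\<close>

lemma Arr_map_trace:
  assumes wd: "wiring_diagram \<Phi>"
    and packs: "inner_packs \<Phi> = [P]"
    and ports: "ports P = {p, q}" "ports (outer_pack \<Phi>) = {}"
    and links: "links \<Phi> = {l}" "link_resolution \<Phi> l = n"
    and linking: "linking \<Phi> (Inl (0, p)) = l" "linking \<Phi> (Inl (0, q)) = l"
    and A: "A \<in> carrier_mat n n"
  shows "Arr_map \<Phi> [arr_of_mat P p q A] = arr_of_scalar (outer_pack \<Phi>) (mat_trace A)"
    (is "?L = ?R")
proof
  fix e'
  show "?L e' = ?R e'"
  proof (cases "e' \<in> Entr (outer_pack \<Phi>)")
    case True
    \<comment> \<open>Without outer ports there is no coordinate to compare, so every link entry
      lies over \<open>e'\<close>.\<close>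
    have outer: "Entr_outer \<Phi> e = e'" for e
      using True by (intro Entr_outer_eqI) (auto simp: ports)
    have "?L e' = (\<Sum>e\<in>Entr_links \<Phi>. A $$ (e l - 1, e l - 1))"
      unfolding Arr_map_apply[OF True]
    proof (rule sum.cong)
      fix e
      assume "e \<in> Entr_links \<Phi>"
      then show "(\<Prod>i<length (inner_packs \<Phi>). ([arr_of_mat P p q A] ! i) (Entr_inner \<Phi> i e)) =
          A $$ (e l - 1, e l - 1)"
        using arr_of_mat_Entr_inner[OF wd, of e 0 p q A] linking
        by (simp add: packs ports)
    qed (simp add: outer)
    also have "\<dots> = (\<Sum>k<n. A $$ (k, k))"
    \<comment> \<open>With a single link, a link entry amounts to one number, so a constant
      function, shifted by one, is the inverse.\<close>
    proof (rule sum.reindex_bij_witness[where i = "\<lambda>k. restrict (\<lambda>_. Suc k) (links \<Phi>)"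
            and j = "\<lambda>e. e l - 1"])
      fix e
      assume e: "e \<in> Entr_links \<Phi>"
      have l: "e l \<in> {1..n}"
        using Entr_links_mem[OF e, of l] by (simp add: links)
      then show "e l - 1 \<in> {..<n}"
        by auto
      show "restrict (\<lambda>_. Suc (e l - 1)) (links \<Phi>) = e"
        using l by (intro Entr_links_eqI[OF e]) (auto simp: links)
    next
      fix k
      assume "k \<in> {..<n}"
      then show "restrict (\<lambda>_. Suc k) (links \<Phi>) \<in> Entr_links \<Phi>"
        by (intro Entr_linksI) (auto simp: links)
    qed (simp_all add: links)
    also have "\<dots> = ?R e'"
      using A True by (simp add: arr_of_scalar_def mat_trace_def)
    finally show ?thesis .
  qed (simp add: Arr_map_outside arr_of_scalar_def)
qed

section \<open>Kronecker product\<close>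

text \<open>Since \<open>i' < m'\<close> and \<open>j' < n'\<close>, \<open>div\<close> and
  \<open>mod\<close> recover the block position and the position inside the block.\<close>

lemma kronecker_mat_index:
  assumes "A \<in> carrier_mat m n" "B \<in> carrier_mat m' n'"
    and "i < m" "i' < m'" "j < n" "j' < n'"
  shows "kronecker_mat A B $$ (i * m' + i', j * n' + j') = A $$ (i, j) * B $$ (i', j')"
proof -
  \<comment> \<open>Mixed-radix bound, used for rows and columns to place the combined indices
    inside the product matrix.\<close>
  have bound: "a * d + b < c * d" if "a < c" "b < d" for a b c d :: nat
  proof -
    have "a * d + b < Suc a * d"
      using that by simp
    also have "\<dots> \<le> c * d"
      using that by (intro mult_le_mono1) simp
    finally show ?thesis .
  qed
  have "i * m' + i' < m * m'" "j * n' + j' < n * n'"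
    using assms(3-6) by (simp_all add: bound)
  then show ?thesis
    using assms by (simp add: kronecker_mat_def)
qed

text \<open>Every link carries an outer port, so exactly one link entry lies over \<open>e'\<close>
  and the sum collapses to one product.\<close>

lemma Arr_map_kronecker_entry:
  assumes wd: "wiring_diagram \<Phi>"
    and packs: "inner_packs \<Phi> = [P\<^sub>1, P\<^sub>2]"
    and ports: "ports P\<^sub>1 = {p\<^sub>1, q\<^sub>1}" "ports P\<^sub>2 = {p\<^sub>2, q\<^sub>2}"
      "ports (outer_pack \<Phi>) = {p\<^sub>1', p\<^sub>2', q\<^sub>1', q\<^sub>2'}"
    and links: "links \<Phi> = {k\<^sub>1, k\<^sub>2, l\<^sub>1, l\<^sub>2}" "distinct [k\<^sub>1, k\<^sub>2, l\<^sub>1, l\<^sub>2]"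
    and linking: "linking \<Phi> (Inl (0, p\<^sub>1)) = k\<^sub>1" "linking \<Phi> (Inr p\<^sub>1') = k\<^sub>1"
      "linking \<Phi> (Inl (1, p\<^sub>2)) = k\<^sub>2" "linking \<Phi> (Inr p\<^sub>2') = k\<^sub>2"
      "linking \<Phi> (Inl (0, q\<^sub>1)) = l\<^sub>1" "linking \<Phi> (Inr q\<^sub>1') = l\<^sub>1"
      "linking \<Phi> (Inl (1, q\<^sub>2)) = l\<^sub>2" "linking \<Phi> (Inr q\<^sub>2') = l\<^sub>2"
    and e': "e' \<in> Entr (outer_pack \<Phi>)"
  shows "Arr_map \<Phi> [arr_of_mat P\<^sub>1 p\<^sub>1 q\<^sub>1 M\<^sub>1, arr_of_mat P\<^sub>2 p\<^sub>2 q\<^sub>2 M\<^sub>2] e' =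
           M\<^sub>1 $$ (e' p\<^sub>1' - 1, e' q\<^sub>1' - 1) * M\<^sub>2 $$ (e' p\<^sub>2' - 1, e' q\<^sub>2' - 1)"
proof -
  \<comment> \<open>Each value is forced by the outer port on that link; the last branch is for
    \<open>l\<^sub>2\<close>.\<close>
  define e where "e = restrict (\<lambda>l. if l = k\<^sub>1 then e' p\<^sub>1' else if l = k\<^sub>2 then e' p\<^sub>2'
    else if l = l\<^sub>1 then e' q\<^sub>1' else e' q\<^sub>2') (links \<Phi>)"
  have e_simps: "e k\<^sub>1 = e' p\<^sub>1'" "e k\<^sub>2 = e' p\<^sub>2'" "e l\<^sub>1 = e' q\<^sub>1'" "e l\<^sub>2 = e' q\<^sub>2'"
    using links by (auto simp: e_def)
  have e: "e \<in> Entr_links \<Phi>"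
    using Entr_outer_pack_mem[OF wd e', of p\<^sub>1'] Entr_outer_pack_mem[OF wd e', of p\<^sub>2']
      Entr_outer_pack_mem[OF wd e', of q\<^sub>1'] Entr_outer_pack_mem[OF wd e', of q\<^sub>2'] links(2)
    unfolding e_def by (intro Entr_linksI) (auto simp: links(1) ports linking)
  have "{e. e \<in> Entr_links \<Phi> \<and> Entr_outer \<Phi> e = e'} = {e}"
  \<comment> \<open>Uniqueness comes first: the outer ports determine \<open>d\<close> on all four
    links. Then \<open>e\<close> is checked to lie over \<open>e'\<close>.\<close>
  proof (intro equalityI subsetI)
    fix d
    assume "d \<in> {e. e \<in> Entr_links \<Phi> \<and> Entr_outer \<Phi> e = e'}"
    then have d: "d \<in> Entr_links \<Phi>"
      "d k\<^sub>1 = e' p\<^sub>1'" "d k\<^sub>2 = e' p\<^sub>2'" "d l\<^sub>1 = e' q\<^sub>1'" "d l\<^sub>2 = e' q\<^sub>2'"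
      using Entr_outer_apply[of \<Phi> d e' p\<^sub>1'] Entr_outer_apply[of \<Phi> d e' p\<^sub>2']
        Entr_outer_apply[of \<Phi> d e' q\<^sub>1'] Entr_outer_apply[of \<Phi> d e' q\<^sub>2']
      by (simp_all add: ports linking)
    have "e = d"
      using d(2-) unfolding e_def by (intro Entr_links_eqI[OF d(1)]) (auto simp: links(1))
    then show "d \<in> {e}"
      by simp
  next
    fix d
    assume "d \<in> {e}"
    moreover have "Entr_outer \<Phi> e = e'"
      by (intro Entr_outer_eqI[OF e']) (auto simp: ports linking e_simps)
    ultimately show "d \<in> {e. e \<in> Entr_links \<Phi> \<and> Entr_outer \<Phi> e = e'}"
      using e by simp
  qed
  then show ?thesis
    using arr_of_mat_Entr_inner[OF wd e, of 0 p\<^sub>1 q\<^sub>1 M\<^sub>1]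
      arr_of_mat_Entr_inner[OF wd e, of 1 p\<^sub>2 q\<^sub>2 M\<^sub>2] linking
    by (simp add: Arr_map_apply[OF e'] packs ports lessThan_Suc mult.commute e_simps)
qed

text \<open>Once the coordinates are in range, the block encoding evaluates to the product already
  found entrywise.\<close>

lemma Arr_map_kronecker:
  assumes wd: "wiring_diagram \<Phi>"
    and packs: "inner_packs \<Phi> = [P\<^sub>1, P\<^sub>2]"
    and ports: "ports P\<^sub>1 = {p\<^sub>1, q\<^sub>1}" "ports P\<^sub>2 = {p\<^sub>2, q\<^sub>2}"
      "ports (outer_pack \<Phi>) = {p\<^sub>1', p\<^sub>2', q\<^sub>1', q\<^sub>2'}"
    and res: "resolution P\<^sub>1 p\<^sub>1 = m\<^sub>1" "resolution P\<^sub>1 q\<^sub>1 = n\<^sub>1"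
      "resolution P\<^sub>2 p\<^sub>2 = m\<^sub>2" "resolution P\<^sub>2 q\<^sub>2 = n\<^sub>2"
    and links: "links \<Phi> = {k\<^sub>1, k\<^sub>2, l\<^sub>1, l\<^sub>2}" "distinct [k\<^sub>1, k\<^sub>2, l\<^sub>1, l\<^sub>2]"
    and linking: "linking \<Phi> (Inl (0, p\<^sub>1)) = k\<^sub>1" "linking \<Phi> (Inr p\<^sub>1') = k\<^sub>1"
      "linking \<Phi> (Inl (1, p\<^sub>2)) = k\<^sub>2" "linking \<Phi> (Inr p\<^sub>2') = k\<^sub>2"
      "linking \<Phi> (Inl (0, q\<^sub>1)) = l\<^sub>1" "linking \<Phi> (Inr q\<^sub>1') = l\<^sub>1"
      "linking \<Phi> (Inl (1, q\<^sub>2)) = l\<^sub>2" "linking \<Phi> (Inr q\<^sub>2') = l\<^sub>2"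
    and mats: "M\<^sub>1 \<in> carrier_mat m\<^sub>1 n\<^sub>1" "M\<^sub>2 \<in> carrier_mat m\<^sub>2 n\<^sub>2"
  shows "Arr_map \<Phi> [arr_of_mat P\<^sub>1 p\<^sub>1 q\<^sub>1 M\<^sub>1, arr_of_mat P\<^sub>2 p\<^sub>2 q\<^sub>2 M\<^sub>2] =
           arr_of_block_mat (outer_pack \<Phi>) p\<^sub>1' p\<^sub>2' q\<^sub>1' q\<^sub>2' m\<^sub>2 n\<^sub>2 (kronecker_mat M\<^sub>1 M\<^sub>2)"
    (is "?L = ?R")
proof
  fix e'
  show "?L e' = ?R e'"
  proof (cases "e' \<in> Entr (outer_pack \<Phi>)")
    case True
    \<comment> \<open>The matrix sizes are given at the inner ports; the links carry them over to
      bounds on the outer coordinates.\<close>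
    have "link_resolution \<Phi> k\<^sub>1 = m\<^sub>1" "link_resolution \<Phi> k\<^sub>2 = m\<^sub>2"
      "link_resolution \<Phi> l\<^sub>1 = n\<^sub>1" "link_resolution \<Phi> l\<^sub>2 = n\<^sub>2"
      using inner_resolution[OF wd, of 0 p\<^sub>1] inner_resolution[OF wd, of 1 p\<^sub>2]
        inner_resolution[OF wd, of 0 q\<^sub>1] inner_resolution[OF wd, of 1 q\<^sub>2] linking
      by (simp_all add: packs ports res)
    then have "e' p\<^sub>1' \<in> {1..m\<^sub>1}" "e' p\<^sub>2' \<in> {1..m\<^sub>2}" "e' q\<^sub>1' \<in> {1..n\<^sub>1}" "e' q\<^sub>2' \<in> {1..n\<^sub>2}"
      using Entr_outer_pack_mem[OF wd True, of p\<^sub>1'] Entr_outer_pack_mem[OF wd True, of p\<^sub>2']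
        Entr_outer_pack_mem[OF wd True, of q\<^sub>1'] Entr_outer_pack_mem[OF wd True, of q\<^sub>2']
      by (simp_all add: ports linking)
    then have "e' p\<^sub>1' - 1 < m\<^sub>1" "e' p\<^sub>2' - 1 < m\<^sub>2" "e' q\<^sub>1' - 1 < n\<^sub>1" "e' q\<^sub>2' - 1 < n\<^sub>2"
      by auto
    then have "?R e' = M\<^sub>1 $$ (e' p\<^sub>1' - 1, e' q\<^sub>1' - 1) * M\<^sub>2 $$ (e' p\<^sub>2' - 1, e' q\<^sub>2' - 1)"
      using kronecker_mat_index[OF mats] True by (simp add: arr_of_block_mat_def)
    then show ?thesis
      using Arr_map_kronecker_entry[OF wd packs ports links linking True] by simp
  qed (simp add: Arr_map_outside arr_of_block_mat_def)
qed

section \<open>The four claims together\<close>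

theorem theorem3p3p2:
  shows
    "(\<forall>(\<Phi> :: ('p, 'q, 'l) wiring) As i c c' M N.
        wiring_diagram \<Phi> \<longrightarrow> length As = length (inner_packs \<Phi>) \<longrightarrow> i < length As \<longrightarrow>
        (\<forall>j<length As. j \<noteq> i \<longrightarrow> As ! j \<in> Arr (inner_packs \<Phi> ! j)) \<longrightarrow>
        M \<in> Arr (inner_packs \<Phi> ! i) \<longrightarrow> N \<in> Arr (inner_packs \<Phi> ! i) \<longrightarrow>
        Arr_map \<Phi> (As[i := arr_add (inner_packs \<Phi> ! i)
                               (arr_smult (inner_packs \<Phi> ! i) c M)
                               (arr_smult (inner_packs \<Phi> ! i) c' N)]) =
        arr_add (outer_pack \<Phi>)
          (arr_smult (outer_pack \<Phi>) c (Arr_map \<Phi> (As[i := M])))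
          (arr_smult (outer_pack \<Phi>) c' (Arr_map \<Phi> (As[i := N]))))
   \<and>
     (\<forall>(\<Phi> :: ('p, 'q, 'l) wiring) P\<^sub>M P\<^sub>N P' m\<^sub>1 n\<^sub>1 n\<^sub>2 p\<^sub>2 m' p' l\<^sub>m l\<^sub>n l\<^sub>p m n p M N.
        wiring_diagram \<Phi> \<longrightarrow> 2 \<le> m \<longrightarrow> 2 \<le> n \<longrightarrow> 2 \<le> p \<longrightarrow>
        inner_packs \<Phi> = [P\<^sub>M, P\<^sub>N] \<longrightarrow> outer_pack \<Phi> = P' \<longrightarrow>
        ports P\<^sub>M = {m\<^sub>1, n\<^sub>1} \<longrightarrow> m\<^sub>1 \<noteq> n\<^sub>1 \<longrightarrow>
        ports P\<^sub>N = {n\<^sub>2, p\<^sub>2} \<longrightarrow> n\<^sub>2 \<noteq> p\<^sub>2 \<longrightarrow>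
        ports P' = {m', p'} \<longrightarrow> m' \<noteq> p' \<longrightarrow>
        links \<Phi> = {l\<^sub>m, l\<^sub>n, l\<^sub>p} \<longrightarrow> distinct [l\<^sub>m, l\<^sub>n, l\<^sub>p] \<longrightarrow>
        link_resolution \<Phi> l\<^sub>m = m \<longrightarrow> link_resolution \<Phi> l\<^sub>n = n \<longrightarrow> link_resolution \<Phi> l\<^sub>p = p \<longrightarrow>
        linking \<Phi> (Inl (0, m\<^sub>1)) = l\<^sub>m \<longrightarrow> linking \<Phi> (Inr m') = l\<^sub>m \<longrightarrow>
        linking \<Phi> (Inl (0, n\<^sub>1)) = l\<^sub>n \<longrightarrow> linking \<Phi> (Inl (1, n\<^sub>2)) = l\<^sub>n \<longrightarrow>
        linking \<Phi> (Inl (1, p\<^sub>2)) = l\<^sub>p \<longrightarrow> linking \<Phi> (Inr p') = l\<^sub>p \<longrightarrow>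
        M \<in> carrier_mat m n \<longrightarrow> N \<in> carrier_mat n p \<longrightarrow>
        Arr_map \<Phi> [arr_of_mat P\<^sub>M m\<^sub>1 n\<^sub>1 M, arr_of_mat P\<^sub>N n\<^sub>2 p\<^sub>2 N] = arr_of_mat P' m' p' (M * N))
   \<and>
     (\<forall>(\<Phi> :: ('p, 'q, 'l) wiring) P P' p q l n A.
        wiring_diagram \<Phi> \<longrightarrow> 2 \<le> n \<longrightarrow>
        inner_packs \<Phi> = [P] \<longrightarrow> outer_pack \<Phi> = P' \<longrightarrow>
        ports P = {p, q} \<longrightarrow> p \<noteq> q \<longrightarrow> resolution P p = n \<longrightarrow> resolution P q = n \<longrightarrow>
        ports P' = {} \<longrightarrow>
        links \<Phi> = {l} \<longrightarrow> link_resolution \<Phi> l = n \<longrightarrow>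
        linking \<Phi> (Inl (0, p)) = l \<longrightarrow> linking \<Phi> (Inl (0, q)) = l \<longrightarrow>
        A \<in> carrier_mat n n \<longrightarrow>
        Arr_map \<Phi> [arr_of_mat P p q A] = arr_of_scalar P' (mat_trace A))
   \<and>
     (\<forall>(\<Phi> :: ('p, 'q, 'l) wiring) P\<^sub>1 P\<^sub>2 P' p\<^sub>1 q\<^sub>1 p\<^sub>2 q\<^sub>2 p\<^sub>1' p\<^sub>2' q\<^sub>1' q\<^sub>2' k\<^sub>1 k\<^sub>2 l\<^sub>1 l\<^sub>2 m\<^sub>1 n\<^sub>1 m\<^sub>2 n\<^sub>2 M\<^sub>1 M\<^sub>2.
        wiring_diagram \<Phi> \<longrightarrow> 2 \<le> m\<^sub>1 \<longrightarrow> 2 \<le> n\<^sub>1 \<longrightarrow> 2 \<le> m\<^sub>2 \<longrightarrow> 2 \<le> n\<^sub>2 \<longrightarrow>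
        inner_packs \<Phi> = [P\<^sub>1, P\<^sub>2] \<longrightarrow> outer_pack \<Phi> = P' \<longrightarrow>
        ports P\<^sub>1 = {p\<^sub>1, q\<^sub>1} \<longrightarrow> p\<^sub>1 \<noteq> q\<^sub>1 \<longrightarrow> resolution P\<^sub>1 p\<^sub>1 = m\<^sub>1 \<longrightarrow> resolution P\<^sub>1 q\<^sub>1 = n\<^sub>1 \<longrightarrow>
        ports P\<^sub>2 = {p\<^sub>2, q\<^sub>2} \<longrightarrow> p\<^sub>2 \<noteq> q\<^sub>2 \<longrightarrow> resolution P\<^sub>2 p\<^sub>2 = m\<^sub>2 \<longrightarrow> resolution P\<^sub>2 q\<^sub>2 = n\<^sub>2 \<longrightarrow>
        ports P' = {p\<^sub>1', p\<^sub>2', q\<^sub>1', q\<^sub>2'} \<longrightarrow> distinct [p\<^sub>1', p\<^sub>2', q\<^sub>1', q\<^sub>2'] \<longrightarrow>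
        links \<Phi> = {k\<^sub>1, k\<^sub>2, l\<^sub>1, l\<^sub>2} \<longrightarrow> distinct [k\<^sub>1, k\<^sub>2, l\<^sub>1, l\<^sub>2] \<longrightarrow>
        linking \<Phi> (Inl (0, p\<^sub>1)) = k\<^sub>1 \<longrightarrow> linking \<Phi> (Inr p\<^sub>1') = k\<^sub>1 \<longrightarrow>
        linking \<Phi> (Inl (1, p\<^sub>2)) = k\<^sub>2 \<longrightarrow> linking \<Phi> (Inr p\<^sub>2') = k\<^sub>2 \<longrightarrow>
        linking \<Phi> (Inl (0, q\<^sub>1)) = l\<^sub>1 \<longrightarrow> linking \<Phi> (Inr q\<^sub>1') = l\<^sub>1 \<longrightarrow>
        linking \<Phi> (Inl (1, q\<^sub>2)) = l\<^sub>2 \<longrightarrow> linking \<Phi> (Inr q\<^sub>2') = l\<^sub>2 \<longrightarrow>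
        M\<^sub>1 \<in> carrier_mat m\<^sub>1 n\<^sub>1 \<longrightarrow> M\<^sub>2 \<in> carrier_mat m\<^sub>2 n\<^sub>2 \<longrightarrow>
        Arr_map \<Phi> [arr_of_mat P\<^sub>1 p\<^sub>1 q\<^sub>1 M\<^sub>1, arr_of_mat P\<^sub>2 p\<^sub>2 q\<^sub>2 M\<^sub>2] =
          arr_of_block_mat P' p\<^sub>1' p\<^sub>2' q\<^sub>1' q\<^sub>2' m\<^sub>2 n\<^sub>2 (kronecker_mat M\<^sub>1 M\<^sub>2) \<and>
        (\<forall>e\<in>Entr P'.
           Arr_map \<Phi> [arr_of_mat P\<^sub>1 p\<^sub>1 q\<^sub>1 M\<^sub>1, arr_of_mat P\<^sub>2 p\<^sub>2 q\<^sub>2 M\<^sub>2] e =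
             M\<^sub>1 $$ (e p\<^sub>1' - 1, e q\<^sub>1' - 1) * M\<^sub>2 $$ (e p\<^sub>2' - 1, e q\<^sub>2' - 1)))"
proof (intro conjI, goal_cases)
  case 1
  show ?case
    by (intro allI impI, rule Arr_map_linear)
next
  case 2
  show ?case
    \<comment> \<open>Substitution replaces \<open>P'\<close> by \<open>outer_pack \<Phi>\<close>,
      the form used in the lemma.\<close>
    by (intro allI impI, hypsubst, rule Arr_map_mat_mult) (assumption | rule refl)+
next
  case 3
  show ?case
    by (intro allI impI, hypsubst, rule Arr_map_trace) (assumption | rule refl)+
next
  case 4
  show ?case
    \<comment> \<open>Two goals arise, the block matrix equation and the entry formula, each settled
      by its own lemma.\<close>
    by (intro allI impI conjI ballI, hypsubst, rule Arr_map_kronecker,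
      (assumption | rule refl)+, hypsubst, rule Arr_map_kronecker_entry, (assumption | rule refl)+)
qed

end
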